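(* Let $N\ge 2$, $m\in\mathbb{N}$, $m\geq 1$, and consider the phase oscillator system $\dot{\bm\phi}=\omega\bm 1+F(\bm\phi)$ with $F=(f_1,\dots,f_N)^T$, where $F$ is phase-shift invariant and every $\bm\vartheta\in SM_m$ gives an $m$-splay state $\bm\phi(t)=\Omega t\,\bm 1+\bm\vartheta$ of the system, with a collective frequency $\Omega$. Let $\bm\vartheta\in SM_m$ and let $L=L(\bm\vartheta)=\mathrm{D}F(\bm\vartheta)$ be the Jacobian of $F$ at $\bm\vartheta$, i.e. $l_{ij}=\frac{\partial f_i}{\partial\phi_j}(\bm\vartheta)$ for $i\neq j$ and $l_{ii}=-\sum_{j\ne i}\frac{\partial f_i}{\partial\phi_j}(\bm\vartheta)$. Then: (i) If $2\,\mathrm{Tr}(L^2)\le \mathrm{Tr}(L)^2$, then the $m$-splay state given by $\bm\vartheta$ is linearly stable if and only if $\mathrm{Tr}(L)<0$. (ii) If $2\,\mathrm{Tr}(L^2)>\mathrm{Tr}(L)^2$, then the $m$-splay state given by $\bm\vartheta$ is linearly stable if and only if $\mathrm{Tr}(L)<0$ and $\mathrm{Tr}(L^2)<\mathrm{Tr}(L)^2$.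
   Context: Phases $\phi_i$ are taken modulo $2\pi$, $\bm 1=(1,\dots,1)^T$, $\omega\in\mathbb{R}$, and $F:\mathbb{R}^N\to\mathbb{R}^N$ is continuously differentiable and $2\pi$-periodic in each argument. Order parameter: $Z_m(\bm\phi)=\frac1N\sum_{j=1}^N e^{\mathrm{i}m\phi_j}$ and $R_m(\bm\phi)=|Z_m(\bm\phi)|$. The $m$-splay manifold is $SM_m=\{\bm\vartheta\in[0,2\pi)^N: R_m(\bm\vartheta)=0\}$. An $m$-splay state is a solution of the form $\phi_i(t)=\Omega t+\vartheta_i$ with $R_m(\bm\vartheta)=0$. Standing hypotheses: (1) there is $\Omega\in\mathbb{R}$ such that for all $\bm\vartheta\in SM_m$, $\bm\phi(t)=\Omega t\,\bm 1+\bm\vartheta$ is a solution of the system (equivalently $\omega+f_i(\bm\vartheta)=\Omega$ for all $i$); (2) $F(\bm\phi+\psi\bm 1)=F(\bm\phi)$ for all $\psi\in\mathbb{R}$ and all $\bm\phi$. Linear stability: the variational equation around the $m$-splay state is $\frac{\mathrm d}{\mathrm dt}\delta\bm\phi=L\,\delta\bm\phi$. The matrix $L$ has the eigenvalue $0$ with algebraic multiplicity at least $N-2$ (neutral directions along the family of splay states). The $m$-splay state is called linearly stable if the two remaining eigenvalues of $L$ (the eigenvalues counted with algebraic multiplicity, after removing $N-2$ zeros) have strictly negative real part. *)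

theory Defs
  imports "HOL-Analysis.Analysis" "HOL-Computational_Algebra.Computational_Algebra"
begin

definition order_parameter :: "nat \<Rightarrow> real ^ 'n \<Rightarrow> complex" where
  "order_parameter m \<phi> =
     (1 / of_nat CARD('n)) * (\<Sum>j\<in>UNIV. exp (\<i> * of_nat m * of_real (\<phi> $ j)))"

definition order_modulus :: "nat \<Rightarrow> real ^ 'n \<Rightarrow> real" where
  "order_modulus m \<phi> = cmod (order_parameter m \<phi>)"

definition splay_manifold :: "nat \<Rightarrow> (real ^ 'n) set" where
  "splay_manifold m = {\<theta>. (\<forall>i. 0 \<le> \<theta> $ i \<and> \<theta> $ i < 2 * pi) \<and> order_modulus m \<theta> = 0}"

definition jacobian :: "(real ^ 'n \<Rightarrow> real ^ 'n) \<Rightarrow> real ^ 'n \<Rightarrow> real ^ 'n ^ 'n" where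
  "jacobian F x = matrix (frechet_derivative F (at x))"

definition continuously_differentiable :: "(real ^ 'n \<Rightarrow> real ^ 'n) \<Rightarrow> bool" where
  "continuously_differentiable F \<longleftrightarrow>
     (\<forall>x. F differentiable (at x)) \<and> continuous_on UNIV (jacobian F)"

definition periodic_each_argument :: "(real ^ 'n \<Rightarrow> real ^ 'n) \<Rightarrow> bool" where
  "periodic_each_argument F \<longleftrightarrow> (\<forall>\<phi> i. F (\<phi> + axis i (2 * pi)) = F \<phi>)"

(* In real ^ 'n the numeral 1 is the vector all of whose components are 1. *)
definition phase_shift_invariant :: "(real ^ 'n \<Rightarrow> real ^ 'n) \<Rightarrow> bool" where
  "phase_shift_invariant F \<longleftrightarrow> (\<forall>\<phi> \<psi>. F (\<phi> + \<psi> *\<^sub>R 1) = F \<phi>)"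

(* Phases are lifted to the real line. As the vector field is 2 pi-periodic in each argument,
   a solution on the torus is the same as a solution of the lifted system. *)
definition oscillator_solution ::
    "real \<Rightarrow> (real ^ 'n \<Rightarrow> real ^ 'n) \<Rightarrow> (real \<Rightarrow> real ^ 'n) \<Rightarrow> bool" where
  "oscillator_solution \<omega> F \<phi> \<longleftrightarrow>
     (\<forall>t. (\<phi> has_vector_derivative (\<omega> *\<^sub>R 1 + F (\<phi> t))) (at t))"

definition characteristic_poly :: "'a::comm_ring_1 ^ 'n ^ 'n \<Rightarrow> 'a poly" where
  "characteristic_poly A = det (\<chi> i j. (if i = j then [:0, 1:] else 0) - [:A $ i $ j:])"

(* Complex eigenvalues of a real matrix, counted with algebraic multiplicity. *)
definition eigenvalues_mset :: "real ^ 'n ^ 'n \<Rightarrow> complex multiset" where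
  "eigenvalues_mset A = proots (characteristic_poly (\<chi> i j. complex_of_real (A $ i $ j)))"

(* By phase-shift invariance the Jacobian is constant along t \<mapsto> \<Omega> t 1 + \<theta>, so the variational
   equation of the splay state has the constant coefficient matrix jacobian F \<theta>. *)
definition linearly_stable_splay :: "(real ^ 'n \<Rightarrow> real ^ 'n) \<Rightarrow> real ^ 'n \<Rightarrow> bool" where
  "linearly_stable_splay F \<theta> \<longleftrightarrow>
     (\<exists>\<mu> \<nu>. eigenvalues_mset (jacobian F \<theta>) = replicate_mset (CARD('n) - 2) 0 + {#\<mu>, \<nu>#}
        \<and> Re \<mu> < 0 \<and> Re \<nu> < 0)"

lemma jacobian_partial_derivative:
  assumes "F differentiable (at x)"
  shows "((\<lambda>s. F (x + s *\<^sub>R axis j 1) $ i) has_real_derivative jacobian F x $ i $ j) (at 0)"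
proof -
  let ?D = "frechet_derivative F (at x)"
  have D: "(F has_derivative ?D) (at (x + 0 *\<^sub>R axis j 1))"
    using assms frechet_derivative_works by auto
  have "((\<lambda>s::real. x + s *\<^sub>R axis j 1) has_derivative (\<lambda>s. s *\<^sub>R axis j 1)) (at 0)"
    by (auto intro!: derivative_eq_intros)
  from has_derivative_compose[OF this D]
  have "((\<lambda>s. F (x + s *\<^sub>R axis j 1) $ i) has_derivative (\<lambda>s. ?D (s *\<^sub>R axis j 1) $ i)) (at 0)"
    by (intro bounded_linear.has_derivative[OF bounded_linear_vec_nth])
  moreover have "?D (s *\<^sub>R axis j 1) $ i = jacobian F x $ i $ j * s" for s
    using linear_frechet_derivative[OF assms]
    by (simp add: linear_cmul jacobian_def matrix_def)
  ultimately show ?thesis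
    by (simp add: has_field_derivative_def)
qed

lemma jacobian_diagonal:
  assumes "F differentiable (at x)" and "phase_shift_invariant F"
  shows "jacobian F x $ i $ i = - (\<Sum>j\<in>UNIV - {i}. jacobian F x $ i $ j)"
proof -
  let ?D = "frechet_derivative F (at x)"
  have D: "(F has_derivative ?D) (at (x + 0 *\<^sub>R 1))"
    using assms frechet_derivative_works by auto
  have "((\<lambda>s::real. x + s *\<^sub>R 1) has_derivative (\<lambda>s. s *\<^sub>R 1)) (at 0)"
    by (auto intro!: derivative_eq_intros)
  from has_derivative_compose[OF this D]
  have "((\<lambda>s::real. F x) has_derivative (\<lambda>s. ?D (s *\<^sub>R 1))) (at 0)"
    using assms(2) by (simp add: phase_shift_invariant_def)
  then have "(\<lambda>s::real. ?D (s *\<^sub>R 1)) = (\<lambda>s. 0)"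
    using has_derivative_unique has_derivative_const by blast
  then have "?D 1 = 0"
    by (metis scaleR_one)
  moreover have "?D 1 = jacobian F x *v 1"
    using linear_frechet_derivative[OF assms(1)] by (simp add: jacobian_def matrix_works)
  ultimately have "(\<Sum>j\<in>UNIV. jacobian F x $ i $ j) = 0"
    by (simp add: matrix_vector_mult_def vec_eq_iff)
  then show ?thesis
    by (simp add: sum.remove[of UNIV i] eq_neg_iff_add_eq_0)
qed

end

theory Submission
  imports Defs
begin

text \<open>By periodicity \<open>F\<close> is constant on \<open>{\<phi>. Z\<^sub>m(\<phi>) = 0}\<close>, so the Jacobian \<open>L\<close> annihilates the
  velocity of every curve in that set. Write \<open>z\<^sub>j = exp(\<i>m\<theta>\<^sub>j)\<close>. If two of the \<open>z\<^sub>j\<close> are linearly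
  independent over the reals, the inverse function theorem shows that every \<open>v\<close> with
  \<open>\<Sum>\<^sub>j v\<^sub>j z\<^sub>j = 0\<close> is such a velocity. At the remaining, singular points all \<open>z\<^sub>j\<close> are \<open>\<plusminus>z\<close>, and
  rotating an antipodal pair gives the velocities \<open>e\<^sub>j + e\<^sub>k\<close>. In both cases \<open>L\<close> is a sum of two
  matrices of rank at most 1, so its characteristic polynomial is
  \<open>X\<^sup>N\<^sup>-\<^sup>2 (X\<^sup>2 - Tr(L) X + (Tr(L)\<^sup>2 - Tr(L\<^sup>2)) / 2)\<close>, and the Routh-Hurwitz criterion for the
  quadratic factor decides stability.\<close>

no_notation fps_nth (infixl \<open>$\<close> 75)

subsection \<open>Spectrum of a matrix of rank at most two\<close>

lemma det_replace_row_of_mat_1: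
  fixes p :: "'a::field ^ 'n"
  shows "det (\<chi> i. if i = k then p else axis i 1) = p $ k"
proof -
  have rows: "row i (mat 1 :: 'a^'n^'n) = axis i 1" for i
    by (simp add: row_def mat_def axis_def vec_eq_iff)
  have "(\<Sum>i\<in>UNIV. p $ i *s axis i 1) = p"
    by (simp add: basis_expansion)
  then show ?thesis
    using cramer_lemma_transpose[of k p "mat 1"] by (simp add: rows cong: if_cong)
qed

text \<open>Multilinearity in the rows, which are perturbed one at a time. Splitting a newly
  perturbed row gives the previous determinant plus a multiple of one having \<open>p\<close> as a
  row; there, row operations remove all other perturbations.\<close>

lemma det_mat_1_plus_rank_1:
  fixes u p :: "'a::field ^ 'n"
  shows "det (mat 1 + (\<chi> i j. u $ i * p $ j)) = 1 + (\<Sum>i\<in>UNIV. u $ i * p $ i)"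
proof -
  define M where "M S k = (\<chi> i. if i = k then p else if i \<in> S then axis i 1 + u $ i *s p else axis i 1)"
    for S :: "'n set" and k
  define N where "N S = (\<chi> i. if i \<in> S then axis i 1 + u $ i *s p else axis i 1)" for S :: "'n set"
  have M: "det (M S k) = p $ k" if "finite S" for S k
    using that
  proof induction
    case empty
    then show ?case by (simp add: M_def det_replace_row_of_mat_1 cong: if_cong)
  next
    case (insert l S)
    show ?case
    proof (cases "l = k")
      case True
      then have "M (insert l S) k = M S k" by (auto simp: M_def vec_eq_iff)
      then show ?thesis using insert by simp
    next
      case False
      \<comment> \<open>Row \<open>k\<close> of \<open>M S k\<close> is \<open>p\<close> itself, so
        perturbing row \<open>l\<close> only adds a multiple of row \<open>k\<close> to it.\<close>
      have "M (insert l S) k = (\<chi> i. if i = l then row l (M S k) + u $ l *s row k (M S k) else row i (M S k))"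
        using False insert.hyps by (auto simp: M_def vec_eq_iff row_def)
      then have "det (M (insert l S) k) = det (M S k)"
        by (simp only: det_row_operation[OF False])
      then show ?thesis using insert.IH by simp
    qed
  qed
  have "det (N S) = 1 + (\<Sum>i\<in>S. u $ i * p $ i)" if "finite S" for S
    using that
  proof induction
    case empty
    have "N {} = mat 1" by (simp add: N_def vec_eq_iff mat_def axis_def)
    then show ?case by simp
  next
    case (insert k S)
    have "N (insert k S) = (\<chi> i. if i = k then axis i 1 + u $ k *s p else N S $ i)"
      by (auto simp: N_def vec_eq_iff)
    then have "det (N (insert k S)) = det (\<chi> i. if i = k then axis i 1 else N S $ i)
        + u $ k * det (\<chi> i. if i = k then p else N S $ i)"
      by (simp add: det_row_add det_row_mul)
    moreover have "(\<chi> i. if i = k then axis i 1 else N S $ i) = N S"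
      using insert.hyps by (auto simp: N_def vec_eq_iff)
    moreover have "(\<chi> i. if i = k then p else N S $ i) = M S k"
      by (auto simp: N_def M_def vec_eq_iff)
    ultimately show ?case using insert M by (simp add: algebra_simps)
  qed
  moreover have "N UNIV = mat 1 + (\<chi> i j. u $ i * p $ j)"
    by (auto simp: N_def vec_eq_iff mat_def axis_def)
  ultimately show ?thesis by (metis finite)
qed

lemma matrix_add_rdistrib:
  fixes A B :: "'a::semiring_1 ^ 'n ^ 'm"
  shows "(A + B) ** C = A ** C + B ** C"
  by (simp add: matrix_matrix_mult_def vec_eq_iff distrib_right sum.distrib)

text \<open>The matrix factors as (I + u p^T)(I + v q^T) with v = (I + u p^T)^(-1) w, and each
  factor falls under the rank-one formula. The assumption says that the first factor is
  invertible.\<close>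

lemma det_mat_1_plus_rank_2:
  fixes u p w q :: "'a::field ^ 'n"
  assumes "1 + (\<Sum>i\<in>UNIV. u $ i * p $ i) \<noteq> 0"
  shows "det (mat 1 + (\<chi> i j. u $ i * p $ j + w $ i * q $ j)) =
    (1 + (\<Sum>i\<in>UNIV. u $ i * p $ i)) * (1 + (\<Sum>i\<in>UNIV. w $ i * q $ i))
    - (\<Sum>i\<in>UNIV. u $ i * q $ i) * (\<Sum>i\<in>UNIV. w $ i * p $ i)"
proof -
  define a where "a = 1 + (\<Sum>i\<in>UNIV. u $ i * p $ i)"
  define c where "c = (\<Sum>i\<in>UNIV. w $ i * p $ i)"
  \<comment> \<open>The Sherman-Morrison formula for the solution of (I + u p^T) v = w.\<close>
  define v where "v = (\<chi> i. w $ i - u $ i * c / a)"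
  have a: "a \<noteq> 0" using assms by (simp add: a_def)
  have pv: "(\<Sum>k\<in>UNIV. p $ k * v $ k) = c / a"
  proof -
    have "p $ k * v $ k = w $ k * p $ k - u $ k * p $ k * (c / a)" for k
      by (simp add: v_def algebra_simps)
    then have "(\<Sum>k\<in>UNIV. p $ k * v $ k) = c - (\<Sum>k\<in>UNIV. u $ k * p $ k) * (c / a)"
      by (simp add: sum_subtractf c_def flip: sum_distrib_right sum_divide_distrib)
    also have "\<dots> = c - (a - 1) * (c / a)" by (simp add: a_def)
    finally show ?thesis using a by (simp add: field_simps)
  qed
  have qv: "(\<Sum>i\<in>UNIV. v $ i * q $ i) = (\<Sum>i\<in>UNIV. w $ i * q $ i) - (\<Sum>i\<in>UNIV. u $ i * q $ i) * (c / a)"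
  proof -
    have "v $ i * q $ i = w $ i * q $ i - u $ i * q $ i * (c / a)" for i
      by (simp add: v_def algebra_simps)
    then show ?thesis
      by (simp add: sum_subtractf flip: sum_distrib_right sum_divide_distrib)
  qed
  have "mat 1 + (\<chi> i j. u $ i * p $ j + w $ i * q $ j)
      = (mat 1 + (\<chi> i j. u $ i * p $ j)) ** (mat 1 + (\<chi> i j. v $ i * q $ j))"
  proof -
    have "((\<chi> i j. u $ i * p $ j) ** (\<chi> i j. v $ i * q $ j)) $ i $ j = u $ i * (c / a) * q $ j" for i j
      by (simp add: matrix_matrix_mult_def pv[symmetric] sum_distrib_left sum_distrib_right mult_ac)
    then show ?thesis
      by (simp add: matrix_add_ldistrib matrix_add_rdistrib vec_eq_iff v_def algebra_simps)
  qed
  then have "det (mat 1 + (\<chi> i j. u $ i * p $ j + w $ i * q $ j)) = a * (1 + (\<Sum>i\<in>UNIV. v $ i * q $ i))"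
    by (simp only: det_mul det_mat_1_plus_rank_1 a_def)
  also have "\<dots> = a * (1 + (\<Sum>i\<in>UNIV. w $ i * q $ i)) - (\<Sum>i\<in>UNIV. u $ i * q $ i) * c"
    unfolding qv using a by (simp add: field_simps)
  finally show ?thesis by (simp add: a_def c_def)
qed

section \<open>The characteristic polynomial in terms of traces\<close>

lemma poly_characteristic_poly:
  fixes A :: "'a::comm_ring_1 ^ 'n ^ 'n"
  shows "poly (characteristic_poly A) x = det (mat x - A)"
proof -
  have "poly ((if i = j then [:0, 1:] else 0) - [:A $ i $ j:]) x = (mat x - A) $ i $ j" for i j
    by (simp add: mat_def)
  then show ?thesis
    by (simp add: characteristic_poly_def det_def poly_sum poly_prod)
qed

lemma det_scaled:
  fixes A :: "'a::comm_ring_1 ^ 'n ^ 'n"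
  shows "det (\<chi> i j. x * A $ i $ j) = x ^ CARD('n) * det A"
  using det_rows_mul[of "\<lambda>_. x" "\<lambda>i. A $ i"] by (simp add: vector_scalar_mult_def)

text \<open>Writing x I - A = x (I - A / x) reduces the value at x to the rank-two determinant
  formula. Two polynomials over an infinite field that agree at all but two points are
  equal.\<close>

lemma characteristic_poly_rank_2:
  fixes u p w q :: "'a::field_char_0 ^ 'n"
  assumes "CARD('n) \<ge> 2" and A: "\<And>i j. A $ i $ j = u $ i * p $ j + w $ i * q $ j"
  shows "characteristic_poly A = monom 1 (CARD('n) - 2) *
    [:((trace A)\<^sup>2 - trace (A ** A)) / 2, - trace A, 1:]"
    (is "?l = ?r")
proof -
  define a b c d where "a = (\<Sum>i\<in>UNIV. u $ i * p $ i)" and "b = (\<Sum>i\<in>UNIV. w $ i * q $ i)"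
    and "c = (\<Sum>i\<in>UNIV. u $ i * q $ i)" and "d = (\<Sum>i\<in>UNIV. w $ i * p $ i)"
  have tr: "trace A = a + b"
    by (simp add: trace_def A a_def b_def sum.distrib)
  have "(\<Sum>k\<in>UNIV. A $ i $ k * A $ k $ i) =
      u $ i * p $ i * a + u $ i * q $ i * d + w $ i * p $ i * c + w $ i * q $ i * b" for i
    by (simp add: A a_def b_def c_def d_def algebra_simps sum.distrib sum_distrib_left)
  then have "trace (A ** A) = a * a + c * d + d * c + b * b"
    by (simp add: trace_def matrix_matrix_mult_def sum.distrib sum_distrib_right[symmetric]
        a_def[symmetric] b_def[symmetric] c_def[symmetric] d_def[symmetric])
  \<comment> \<open>The constant coefficient of the quadratic is the determinant of the 2 by 2
    matrix of pairings of \<open>u\<close>, \<open>w\<close> with \<open>p\<close>,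
    \<open>q\<close>.\<close>
  then have D: "((trace A)\<^sup>2 - trace (A ** A)) / 2 = a * b - c * d"
    by (simp add: tr power2_eq_square field_simps)
  \<comment> \<open>Excluding 0 permits division by \<open>x\<close>; excluding \<open>a\<close>
    keeps \<open>1 - a / x\<close> nonzero, as the rank-two formula demands.\<close>
  have eq: "poly ?l x = poly ?r x" if "x \<noteq> 0" "x \<noteq> a" for x
  proof -
    define u' w' where "u' = (\<chi> i. - u $ i / x)" and "w' = (\<chi> i. - w $ i / x)"
    have s: "(\<Sum>i\<in>UNIV. u' $ i * p $ i) = - a / x" "(\<Sum>i\<in>UNIV. w' $ i * q $ i) = - b / x"
      "(\<Sum>i\<in>UNIV. u' $ i * q $ i) = - c / x" "(\<Sum>i\<in>UNIV. w' $ i * p $ i) = - d / x"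
      by (simp_all add: u'_def w'_def a_def b_def c_def d_def sum_negf sum_divide_distrib)
    have "mat x - A = (\<chi> i j. x * (mat 1 + (\<chi> i j. u' $ i * p $ j + w' $ i * q $ j)) $ i $ j)"
      using that by (auto simp: vec_eq_iff mat_def u'_def w'_def A field_simps)
    then have "poly ?l x = x ^ CARD('n) * det (mat 1 + (\<chi> i j. u' $ i * p $ j + w' $ i * q $ j))"
      by (simp only: poly_characteristic_poly det_scaled)
    also have "\<dots> = x ^ CARD('n) * ((1 - a / x) * (1 - b / x) - c / x * (d / x))"
    proof -
      have "1 + (\<Sum>i\<in>UNIV. u' $ i * p $ i) \<noteq> 0"
        unfolding s using that by (simp add: field_simps)
      from det_mat_1_plus_rank_2[OF this, of w' q] show ?thesis
        unfolding s by simp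
    qed
    also have "x ^ CARD('n) = x ^ (CARD('n) - 2) * x\<^sup>2"
      using assms(1) by (metis le_add_diff_inverse2 power_add)
    also have "x ^ (CARD('n) - 2) * x\<^sup>2 * ((1 - a / x) * (1 - b / x) - c / x * (d / x))
        = x ^ (CARD('n) - 2) * ((x - a) * (x - b) - c * d)"
    proof -
      have "x\<^sup>2 * ((1 - a / x) * (1 - b / x) - c / x * (d / x)) = (x - a) * (x - b) - c * d"
        using that by (simp add: power2_eq_square field_simps)
      then show ?thesis by (simp add: mult.assoc)
    qed
    finally show ?thesis
      unfolding D unfolding tr by (simp add: poly_monom algebra_simps)
  qed
  show ?thesis
  proof (rule ccontr)
    assume "?l \<noteq> ?r"
    then have "finite {x. poly (?l - ?r) x = 0}"
      by (intro poly_roots_finite) simp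
    moreover have "UNIV - {0, a} \<subseteq> {x. poly (?l - ?r) x = 0}"
      using eq by auto
    ultimately have "finite (UNIV - {0, a})" by (rule rev_finite_subset)
    then show False by (simp add: infinite_UNIV_char_0)
  qed
qed

section \<open>Roots of the quadratic factor and stability\<close>

lemma complex_monic_quadratic_factors:
  obtains \<mu> \<nu> :: complex where "[:d, - t, 1:] = [:- \<mu>, 1:] * [:- \<nu>, 1:]"
proof -
  define s where "s = csqrt (t\<^sup>2 - 4 * d)"
  have "s * s = t * t - 4 * d"
    by (simp add: s_def flip: power2_eq_square)
  then have "[:d, - t, 1:] = [:- ((t + s) / 2), 1:] * [:- ((t - s) / 2), 1:]"
    by (simp add: field_simps)
  then show ?thesis using that by blast
qed

text \<open>The Routh-Hurwitz criterion in degree two. Reality of the sum and the product leaves two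
  cases: both numbers are real, or they are conjugate and their product is a squared
  modulus.\<close>

lemma Re_neg_iff_of_real_sum_prod:
  fixes \<mu> \<nu> :: complex
  assumes "\<mu> + \<nu> = of_real t" "\<mu> * \<nu> = of_real d"
  shows "Re \<mu> < 0 \<and> Re \<nu> < 0 \<longleftrightarrow> t < 0 \<and> d > 0"
proof -
  have t: "Re \<mu> + Re \<nu> = t" and im: "Im \<nu> = - Im \<mu>"
    using arg_cong[OF assms(1), of Re] arg_cong[OF assms(1), of Im] by simp_all
  have d: "Re \<mu> * Re \<nu> + (Im \<mu>)\<^sup>2 = d" and "Im \<mu> * (Re \<nu> - Re \<mu>) = 0"
    using arg_cong[OF assms(2), of Re] arg_cong[OF assms(2), of Im] im
    by (simp_all add: algebra_simps power2_eq_square)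
  then consider "Im \<mu> = 0" | "Re \<nu> = Re \<mu>" by auto
  then show ?thesis
  proof cases
    case 1
    then show ?thesis using t d by (auto simp: mult_neg_neg zero_less_mult_iff)
  next
    case 2
    then show ?thesis using t d by (auto simp: add_pos_nonneg zero_less_mult_iff)
  qed
qed

lemma proots_monom_times_quadratic:
  fixes \<mu> \<nu> :: complex
  shows "proots (monom 1 k * ([:- \<mu>, 1:] * [:- \<nu>, 1:])) = replicate_mset k 0 + {#\<mu>, \<nu>#}"
proof -
  have "proots (monom 1 k :: complex poly) = replicate_mset k 0"
    by (rule multiset_eqI) (simp add: proots_power monom_altdef)
  moreover have "proots ([:- \<mu>, 1:] * [:- \<nu>, 1:]) = {#\<mu>, \<nu>#}"
    by (subst proots_mult) simp_all
  ultimately show ?thesis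
    by (subst proots_mult) auto
qed

lemma stable_spectrum_rank_2:
  fixes L :: "real ^ 'n ^ 'n"
  assumes "CARD('n) \<ge> 2" and L: "\<And>i j. L $ i $ j = u $ i * p $ j + w $ i * q $ j"
  shows "(\<exists>\<mu> \<nu>. eigenvalues_mset L = replicate_mset (CARD('n) - 2) 0 + {#\<mu>, \<nu>#}
      \<and> Re \<mu> < 0 \<and> Re \<nu> < 0) \<longleftrightarrow> trace L < 0 \<and> trace (L ** L) < (trace L)\<^sup>2"
proof -
  define C where "C = (\<chi> i j. complex_of_real (L $ i $ j))"
  define d where "d = ((trace L)\<^sup>2 - trace (L ** L)) / 2"
  have tr: "trace C = of_real (trace L)" "trace (C ** C) = of_real (trace (L ** L))"
    by (simp_all add: C_def trace_def matrix_matrix_mult_def)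
  have "characteristic_poly C = monom 1 (CARD('n) - 2) *
      [:((trace C)\<^sup>2 - trace (C ** C)) / 2, - trace C, 1:]"
    by (rule characteristic_poly_rank_2[OF assms(1), where
          u = "\<chi> i. of_real (u $ i)" and p = "\<chi> i. of_real (p $ i)"
          and w = "\<chi> i. of_real (w $ i)" and q = "\<chi> i. of_real (q $ i)"])
      (simp add: C_def L)
  then have char: "characteristic_poly C = monom 1 (CARD('n) - 2) *
      [:of_real d, - of_real (trace L), 1:]"
    by (simp add: tr d_def)
  obtain \<mu> \<nu> :: complex
    where fac: "[:of_real d, - of_real (trace L), 1:] = [:- \<mu>, 1:] * [:- \<nu>, 1:]"
    by (rule complex_monic_quadratic_factors)
  have ev: "eigenvalues_mset L = replicate_mset (CARD('n) - 2) 0 + {#\<mu>, \<nu>#}"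
    unfolding eigenvalues_mset_def C_def[symmetric] char fac by (rule proots_monom_times_quadratic)
  have sums: "\<mu> + \<nu> = of_real (trace L)" "\<mu> * \<nu> = of_real d"
    using fac by (simp_all add: algebra_simps)
  have "(\<exists>\<mu>' \<nu>'. eigenvalues_mset L = replicate_mset (CARD('n) - 2) 0 + {#\<mu>', \<nu>'#}
      \<and> Re \<mu>' < 0 \<and> Re \<nu>' < 0) \<longleftrightarrow> Re \<mu> < 0 \<and> Re \<nu> < 0"
  proof -
    \<comment> \<open>Cancelling the common zeros identifies any admissible pair with the two
      computed roots up to order, so the existential quantifier offers no real choice.\<close>
    have "Re \<mu> < 0 \<and> Re \<nu> < 0"
      if "{#\<mu>, \<nu>#} = {#\<mu>', \<nu>'#}" "Re \<mu>' < 0" "Re \<nu>' < 0" for \<mu>' \<nu>'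
    proof -
      have "{\<mu>, \<nu>} = {\<mu>', \<nu>'}" using arg_cong[OF that(1), of set_mset] by simp
      then have "\<mu> \<in> {\<mu>', \<nu>'}" "\<nu> \<in> {\<mu>', \<nu>'}" by blast+
      then show ?thesis using that(2,3) by blast
    qed
    then show ?thesis
      unfolding ev add_left_cancel by blast
  qed
  also have "\<dots> \<longleftrightarrow> trace L < 0 \<and> d > 0"
    using sums by (rule Re_neg_iff_of_real_sum_prod)
  finally show ?thesis by (simp add: d_def)
qed

subsection \<open>The Jacobian on the splay manifold\<close>

lemma sum_remove_two:
  fixes h :: "'a::finite \<Rightarrow> 'b::comm_monoid_add"
  assumes "a \<noteq> b"
  shows "(\<Sum>j\<in>UNIV. h j) = h a + h b + (\<Sum>j\<in>UNIV-{a,b}. h j)"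
proof -
  have "UNIV - {a} - {b} = UNIV - {a, b}" by auto
  then show ?thesis
    using assms by (simp add: sum.remove[of UNIV a] sum.remove[of "UNIV - {a}" b] add_ac)
qed

section \<open>Prescribing the sum of two phase factors\<close>

lemma has_vector_derivative_phase:
  "((\<lambda>t. exp (\<i> * of_nat m * complex_of_real t)) has_vector_derivative
    \<i> * of_nat m * exp (\<i> * of_nat m * complex_of_real t)) (at t within S)"
proof -
  have "((\<lambda>z. exp (\<i> * of_nat m * z)) has_field_derivative \<i> * of_nat m * exp (\<i> * of_nat m * of_real t))
      (at (complex_of_real t))"
    by (auto intro!: derivative_eq_intros)
  from has_vector_derivative_real_field[OF this] show ?thesis by (simp add: o_def)
qed

text \<open>A complex number encodes a pair of real phases by its real and imaginary part.
  \<open>Im (cnj (e a) * e b)\<close> is the determinant of \<open>e a\<close>, \<open>e b\<close>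
  as plane vectors, so \<open>indep\<close> makes the derivative of the sum invertible and the
  inverse function theorem applies. The last clause says that \<open>g'\<close> recovers the phase
  velocities from the velocity of the sum.\<close>

lemma sum_of_two_phases_local_inverse:
  fixes m :: nat and a b :: real
  defines "e \<equiv> \<lambda>t. exp (\<i> * of_nat m * complex_of_real t)"
  assumes "m \<ge> 1" and indep: "Im (cnj (e a) * e b) \<noteq> 0"
  obtains V :: "complex set" and g g' where "open V" "e a + e b \<in> V"
    "\<And>y. y \<in> V \<Longrightarrow> e (Re (g y)) + e (Im (g y)) = y"
    "g (e a + e b) = Complex a b"
    "(g has_derivative g') (at (e a + e b))"
    "\<And>v w. g' (\<i> * of_nat m * (of_real v * e a + of_real w * e b)) = Complex v w"
proof -
  define f where "f z = e (Re z) + e (Im z)" for z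
  \<comment> \<open>The derivative is a bounded linear function object because the inverse function
    theorem asks for its continuity in operator norm.\<close>
  define f' where "f' z = (blinfun_scaleR_left (\<i> * of_nat m * e (Re z)) o\<^sub>L Blinfun Re)
      + (blinfun_scaleR_left (\<i> * of_nat m * e (Im z)) o\<^sub>L Blinfun Im)" for z
  have f': "blinfun_apply (f' z) h = Re h *\<^sub>R (\<i> * of_nat m * e (Re z)) + Im h *\<^sub>R (\<i> * of_nat m * e (Im z))" for z h
    by (simp add: f'_def blinfun.add_left bounded_linear_Blinfun_apply bounded_linear_Re bounded_linear_Im)
  have der: "(f has_derivative blinfun_apply (f' z)) (at z)" for z
  proof -
    have e': "(e has_derivative (\<lambda>r. r *\<^sub>R (\<i> * of_nat m * e t))) (at t)" for t
      using has_vector_derivative_phase[of m t UNIV] by (simp add: e_def has_vector_derivative_def)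
    show ?thesis
      unfolding f_def f'[abs_def]
      by (intro has_derivative_add has_derivative_compose[OF _ e']
          bounded_linear_imp_has_derivative bounded_linear_Re bounded_linear_Im)
  qed
  have cont: "continuous_on UNIV f'"
    unfolding f'_def e_def by (intro continuous_intros)
  let ?x = "Complex a b"
  have "inj (blinfun_apply (f' ?x))"
    unfolding linear_injective_0[OF bounded_linear.linear[OF blinfun.bounded_linear_right]]
  proof (intro allI impI)
    fix h assume "blinfun_apply (f' ?x) h = 0"
    then have "\<i> * of_nat m * (of_real (Re h) * e a + of_real (Im h) * e b) = 0"
      by (simp add: f' scaleR_conv_of_real algebra_simps)
    then have z: "of_real (Re h) * e a + of_real (Im h) * e b = 0"
      using \<open>m \<ge> 1\<close> by simp
    \<comment> \<open>Taking the determinant of the linear relation with \<open>e a\<close>, and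
      then with \<open>e b\<close>, isolates one coefficient each time.\<close>
    have "Im (cnj (e a) * (of_real (Re h) * e a + of_real (Im h) * e b)) = Im h * Im (cnj (e a) * e b)"
      by (simp add: algebra_simps)
    moreover have "Im (cnj (of_real (Re h) * e a + of_real (Im h) * e b) * e b) = Re h * Im (cnj (e a) * e b)"
      by (simp add: algebra_simps)
    ultimately show "h = 0"
      using indep z by (simp add: complex_eq_iff)
  qed
  then obtain k where k: "linear k" "k \<circ> blinfun_apply (f' ?x) = id"
    using linear_injective_left_inverse[of "blinfun_apply (f' ?x)"]
    by (auto simp: blinfun.bounded_linear_right bounded_linear.linear)
  then have "Blinfun k o\<^sub>L f' ?x = id_blinfun"
    by (intro blinfun_eqI) (simp add: bounded_linear_Blinfun_apply linear_conv_bounded_linear pointfree_idE)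
  then obtain U V g g' where UV: "open U" "U \<subseteq> UNIV" "?x \<in> U" "open V" "f ?x \<in> V" "homeomorphism U V f g"
    "\<And>y. y \<in> V \<Longrightarrow> (g has_derivative (g' y)) (at y)"
    "\<And>y. y \<in> V \<Longrightarrow> g' y = inv (blinfun_apply (f'(g y)))"
    "\<And>y. y \<in> V \<Longrightarrow> bij (blinfun_apply (f'(g y)))"
    by (rule inverse_function_theorem[OF open_UNIV der cont UNIV_I]) (rule that)
  have fx: "f ?x = e a + e b" by (simp add: f_def)
  have gx: "g (f ?x) = ?x" using UV by (simp add: homeomorphism_def)
  show ?thesis
  proof
    show "open V" "e a + e b \<in> V" "g (e a + e b) = ?x"
      and "(g has_derivative g' (e a + e b)) (at (e a + e b))"
      using UV(4,5) UV(7)[OF UV(5)] gx by (simp_all add: fx)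
    show "e (Re (g y)) + e (Im (g y)) = y" if "y \<in> V" for y
      using UV(6) that unfolding homeomorphism_def f_def by blast
    show "g' (e a + e b) (\<i> * of_nat m * (of_real v * e a + of_real w * e b)) = Complex v w" for v w
    proof -
      have "\<i> * of_nat m * (of_real v * e a + of_real w * e b) = blinfun_apply (f' ?x) (Complex v w)"
        by (simp add: f' scaleR_conv_of_real algebra_simps)
      then show ?thesis
        using UV(8,9)[OF UV(5)] by (simp add: gx fx[symmetric] bij_is_inj)
    qed
  qed
qed

section \<open>Directions annihilated by the Jacobian, and its rank\<close>

text \<open>The chain rule at 0, applied to a composition that is locally constant.\<close>

lemma jacobian_curve:
  fixes \<gamma> :: "real \<Rightarrow> real ^ 'n" and F :: "real ^ 'n \<Rightarrow> real ^ 'n"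
  assumes "F differentiable (at (\<gamma> 0))" "(\<gamma> has_vector_derivative v) (at 0)"
    and "eventually (\<lambda>s. F (\<gamma> s) = c) (nhds 0)"
  shows "jacobian F (\<gamma> 0) *v v = 0"
proof -
  let ?D = "frechet_derivative F (at (\<gamma> 0))"
  have "(F has_derivative ?D) (at (\<gamma> 0))"
    using assms(1) frechet_derivative_works by blast
  from has_derivative_compose[OF assms(2)[unfolded has_vector_derivative_def] this]
  have "((\<lambda>s. F (\<gamma> s)) has_derivative (\<lambda>s. ?D (s *\<^sub>R v))) (at 0)" .
  moreover have "((\<lambda>s. F (\<gamma> s)) has_derivative (\<lambda>s. 0)) (at 0)"
    by (rule has_derivative_transform_eventually[of "\<lambda>_. c"])
      (use assms(3) eventually_nhds_x_imp_x[OF assms(3)] in \<open>auto simp: eventually_at_filter elim: eventually_mono\<close>)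
  ultimately have "(\<lambda>s. ?D (s *\<^sub>R v)) = (\<lambda>s. 0)"
    using has_derivative_unique by blast
  then have "?D v = 0" by (metis scaleR_one)
  then show ?thesis
    using linear_frechet_derivative[OF assms(1)] by (simp add: jacobian_def matrix_works)
qed

text \<open>A curve in the zero set with velocity \<open>v\<close> is constructed: every phase
  except \<open>a\<close> and \<open>b\<close> moves linearly, and the local inverse adjusts these
  two so that the sum stays zero. The condition on \<open>v\<close> then forces their velocities to
  be \<open>v $ a\<close> and \<open>v $ b\<close>.\<close>

lemma jacobian_kernel_noncollinear:
  fixes F :: "real ^ 'n \<Rightarrow> real ^ 'n" and m :: nat
  defines "e \<equiv> \<lambda>t. exp (\<i> * of_nat m * complex_of_real t)"
  assumes "m \<ge> 1" and "F differentiable (at \<theta>)"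
    and const: "\<And>\<phi>. (\<Sum>j\<in>UNIV. e (\<phi> $ j)) = 0 \<Longrightarrow> F \<phi> = c"
    and zero: "(\<Sum>j\<in>UNIV. e (\<theta> $ j)) = 0"
    and indep: "Im (cnj (e (\<theta> $ a)) * e (\<theta> $ b)) \<noteq> 0"
    and v: "(\<Sum>j\<in>UNIV. of_real (v $ j) * e (\<theta> $ j)) = 0"
  shows "jacobian F \<theta> *v v = 0"
proof -
  have "a \<noteq> b" using indep by auto
  note split = sum_remove_two[OF \<open>a \<noteq> b\<close>]
  let ?y = "e (\<theta> $ a) + e (\<theta> $ b)"
  obtain V g g' where V: "open V" "?y \<in> V"
    and g: "\<And>y. y \<in> V \<Longrightarrow> e (Re (g y)) + e (Im (g y)) = y" "g ?y = Complex (\<theta> $ a) (\<theta> $ b)"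
    and g': "(g has_derivative g') (at ?y)"
      "\<And>v w. g' (\<i> * of_nat m * (of_real v * e (\<theta> $ a) + of_real w * e (\<theta> $ b))) = Complex v w"
    by (rule sum_of_two_phases_local_inverse[OF \<open>m \<ge> 1\<close> indep[unfolded e_def]])
      (rule that[unfolded e_def])
  \<comment> \<open>The value that the two adjusted phase factors must add up to at time
    \<open>s\<close>.\<close>
  define S where "S s = - (\<Sum>j\<in>UNIV-{a,b}. e (\<theta> $ j + s * v $ j))" for s
  have S0: "S 0 = ?y"
    using zero unfolding split by (simp add: S_def add_eq_0_iff2)
  have "((\<lambda>s. e (\<theta> $ j + s * v $ j)) has_vector_derivative v $ j *\<^sub>R (\<i> * of_nat m * e (\<theta> $ j))) (at 0)" for j
  proof -
    have "((\<lambda>s. \<theta> $ j + s * v $ j) has_vector_derivative v $ j) (at 0)"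
      by (auto intro!: derivative_eq_intros)
    moreover have "(e has_vector_derivative \<i> * of_nat m * e (\<theta> $ j)) (at (\<theta> $ j + 0 * v $ j))"
      using has_vector_derivative_phase[of m "\<theta> $ j" UNIV] by (simp add: e_def)
    ultimately show ?thesis
      using vector_diff_chain_at by (fastforce simp: o_def)
  qed
  then have "(S has_vector_derivative
      - (\<Sum>j\<in>UNIV-{a,b}. v $ j *\<^sub>R (\<i> * of_nat m * e (\<theta> $ j)))) (at 0)"
    unfolding S_def by (intro has_vector_derivative_minus has_vector_derivative_sum)
  also have "- (\<Sum>j\<in>UNIV-{a,b}. v $ j *\<^sub>R (\<i> * of_nat m * e (\<theta> $ j)))
      = \<i> * of_nat m * - (\<Sum>j\<in>UNIV-{a,b}. of_real (v $ j) * e (\<theta> $ j))"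
    by (simp add: sum_distrib_left scaleR_conv_of_real mult_ac)
  also have "- (\<Sum>j\<in>UNIV-{a,b}. of_real (v $ j) * e (\<theta> $ j))
      = of_real (v $ a) * e (\<theta> $ a) + of_real (v $ b) * e (\<theta> $ b)"
    using v unfolding split by (simp add: add_eq_0_iff2)
  finally have S: "(S has_vector_derivative
      \<i> * of_nat m * (of_real (v $ a) * e (\<theta> $ a) + of_real (v $ b) * e (\<theta> $ b))) (at 0)" .
  define h where "h s = g (S s)" for s
  have h0: "h 0 = Complex (\<theta> $ a) (\<theta> $ b)" by (simp add: h_def S0 g)
  have "(g has_derivative g') (at (S 0))" using g' by (simp add: S0)
  from has_derivative_compose[OF S[unfolded has_vector_derivative_def] this]
  have h: "(h has_vector_derivative Complex (v $ a) (v $ b)) (at 0)"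
    unfolding h_def has_vector_derivative_def
    using bounded_linear.linear[OF has_derivative_bounded_linear[OF g'(1)]] g'(2)
    by (simp add: linear_cmul)
  define x where "x s = Re (h s)" for s
  define y where "y s = Im (h s)" for s
  have x: "(x has_vector_derivative v $ a) (at 0)" and y: "(y has_vector_derivative v $ b) (at 0)"
    unfolding x_def y_def using bounded_linear.has_vector_derivative[OF bounded_linear_Re h]
      bounded_linear.has_vector_derivative[OF bounded_linear_Im h] by simp_all
  \<comment> \<open>The straight line through \<open>\<theta>\<close> with entries \<open>a\<close>
    and \<open>b\<close> overwritten by \<open>x s\<close> and \<open>y s\<close>. In this form both
    corrections vanish to first order at 0, so the velocity is \<open>v\<close>.\<close>
  define \<gamma> where "\<gamma> s = \<theta> + s *\<^sub>R v + (x s - \<theta> $ a - s * v $ a) *\<^sub>R axis a 1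
      + (y s - \<theta> $ b - s * v $ b) *\<^sub>R axis b 1" for s
  have \<gamma>0: "\<gamma> 0 = \<theta>" by (simp add: \<gamma>_def x_def y_def h0)
  have \<gamma>': "(\<gamma> has_vector_derivative v) (at 0)"
    using x y unfolding \<gamma>_def has_vector_derivative_def
    by (auto intro!: derivative_eq_intros simp: algebra_simps)
  have "continuous (at 0) S"
    using S has_vector_derivative_continuous by blast
  then have "eventually (\<lambda>s. S s \<in> V) (nhds 0)"
    using V S0 by (metis continuous_at_open tendsto_at_iff_tendsto_nhds continuous_at topological_tendstoD)
  then have "eventually (\<lambda>s. F (\<gamma> s) = c) (nhds 0)"
  proof eventually_elim
    case (elim s)
    have "\<gamma> s $ a = Re (h s)" "\<gamma> s $ b = Im (h s)"
      using \<open>a \<noteq> b\<close> by (simp_all add: \<gamma>_def axis_def x_def y_def)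
    moreover have "\<gamma> s $ j = \<theta> $ j + s * v $ j" if "j \<in> UNIV - {a, b}" for j
      using that by (simp add: \<gamma>_def axis_def)
    then have "(\<Sum>j\<in>UNIV-{a,b}. e (\<gamma> s $ j)) = - S s"
      by (simp add: S_def)
    ultimately show ?case
      using g(1)[OF elim] by (intro const) (simp add: split h_def)
  qed
  then show ?thesis
    using jacobian_curve[of F \<gamma> v c] assms(3) \<gamma>' by (simp add: \<gamma>0)
qed

text \<open>Kernel vectors turn linear relations between the phase factors into relations between
  the columns of the Jacobian: every column is a combination of columns \<open>a\<close> and
  \<open>b\<close>, or, in the collinear case, a signed copy of column \<open>a\<close>.\<close>

lemma splay_jacobian_rank_2:
  fixes F :: "real ^ 'n \<Rightarrow> real ^ 'n" and m :: nat
  defines "e \<equiv> \<lambda>t. exp (\<i> * of_nat m * complex_of_real t)"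
  assumes "m \<ge> 1" and "F differentiable (at \<theta>)"
    and const: "\<And>\<phi>. (\<Sum>j\<in>UNIV. e (\<phi> $ j)) = 0 \<Longrightarrow> F \<phi> = c"
    and zero: "(\<Sum>j\<in>UNIV. e (\<theta> $ j)) = 0"
  obtains u p w q :: "real ^ 'n"
  where "\<And>i j. jacobian F \<theta> $ i $ j = u $ i * p $ j + w $ i * q $ j"
proof -
  define L where "L = jacobian F \<theta>"
  have L_axis: "(L *v axis j 1) $ i = L $ i $ j" for i j
    by (simp add: matrix_vector_mul_component inner_axis)
  have norm_e: "cmod (e t) = 1" for t
    using norm_exp_i_times[of "of_nat m * t"] by (simp add: e_def mult.assoc)
  show ?thesis
  proof (cases "\<exists>a b. Im (cnj (e (\<theta> $ a)) * e (\<theta> $ b)) \<noteq> 0")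
    case True
    then obtain a b where ab: "Im (cnj (e (\<theta> $ a)) * e (\<theta> $ b)) \<noteq> 0" by blast
    define d where "d = Im (cnj (e (\<theta> $ a)) * e (\<theta> $ b))"
    define p where "p = (\<chi> j. Im (cnj (e (\<theta> $ j)) * e (\<theta> $ b)) / d)"
    define q where "q = (\<chi> j. Im (cnj (e (\<theta> $ a)) * e (\<theta> $ j)) / d)"
    \<comment> \<open>Cramer's rule in the plane; it supplies the coordinates \<open>p\<close> and
      \<open>q\<close> of each phase factor in the basis given by \<open>a\<close> and
      \<open>b\<close>.\<close>
    have cramer: "of_real (Im (cnj x * y)) * z = of_real (Im (cnj z * y)) * x + of_real (Im (cnj x * z)) * y"
      for x y z by (simp add: complex_eq_iff algebra_simps)
    have e: "e (\<theta> $ j) = of_real (p $ j) * e (\<theta> $ a) + of_real (q $ j) * e (\<theta> $ b)" for j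
    proof -
      have "d \<noteq> 0" using ab by (simp add: d_def)
      then have "e (\<theta> $ j) = of_real d * e (\<theta> $ j) / of_real d" by simp
      also have "\<dots> = of_real (p $ j) * e (\<theta> $ a) + of_real (q $ j) * e (\<theta> $ b)"
        unfolding d_def cramer[of _ _ "e (\<theta> $ j)"] by (simp add: p_def q_def d_def add_divide_distrib)
      finally show ?thesis .
    qed
    have L: "L $ i $ j = L $ i $ a * p $ j + L $ i $ b * q $ j" for i j
    proof -
      \<comment> \<open>The relation \<open>e\<close> puts this vector into the kernel, and applying
        \<open>L\<close> to it expresses column \<open>j\<close> by columns \<open>a\<close> and
        \<open>b\<close>.\<close>
      let ?v = "axis j 1 - p $ j *\<^sub>R axis a 1 - q $ j *\<^sub>R axis b (1::real)"
      have ax: "(\<Sum>l\<in>UNIV. of_real (axis k 1 $ l) * z l) = (z k :: complex)" for k :: 'n and z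
      proof -
        have "of_real (axis k 1 $ l) * z l = (if l = k then z l else 0)" for l
          by (simp add: axis_def)
        then show ?thesis by simp
      qed
      have "of_real (?v $ l) * e (\<theta> $ l) = of_real (axis j 1 $ l) * e (\<theta> $ l)
          - of_real (p $ j) * (of_real (axis a 1 $ l) * e (\<theta> $ l))
          - of_real (q $ j) * (of_real (axis b 1 $ l) * e (\<theta> $ l))" for l
        by (simp add: algebra_simps)
      then have "(\<Sum>l\<in>UNIV. of_real (?v $ l) * e (\<theta> $ l)) = 0"
        by (simp only: sum_subtractf sum_distrib_left[symmetric] ax) (simp add: e[of j])
      then have "L *v ?v = 0"
        unfolding L_def
        using jacobian_kernel_noncollinear[OF assms(2,3) const[unfolded e_def] zero[unfolded e_def]
            ab[unfolded e_def]] by (simp add: e_def)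
      then have "(L *v axis j 1 - p $ j *\<^sub>R (L *v axis a 1) - q $ j *\<^sub>R (L *v axis b 1)) $ i = 0"
        by (simp add: matrix_vector_mult_diff_distrib matrix_vector_mult_scaleR)
      then show ?thesis by (simp add: L_axis algebra_simps)
    qed
    show ?thesis
    proof (rule that)
      show "jacobian F \<theta> $ i $ j = (\<chi> i. L $ i $ a) $ i * p $ j + (\<chi> i. L $ i $ b) $ i * q $ j" for i j
        using L[of i j] by (simp add: L_def)
    qed
  next
    case False
    fix a :: 'n
    \<comment> \<open>All phase factors are real multiples of the one at \<open>a\<close> and have
      modulus 1, so these ratios are signs.\<close>
    define \<sigma> where "\<sigma> = (\<chi> j. Re (cnj (e (\<theta> $ a)) * e (\<theta> $ j)))"
    have rot: "cnj (e (\<theta> $ a)) * e (\<theta> $ j) = of_real (\<sigma> $ j)" for j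
    proof -
      have "Im (cnj (e (\<theta> $ a)) * e (\<theta> $ j)) = 0" using False by blast
      then show ?thesis unfolding \<sigma>_def complex_eq_iff by (simp del: complex_cnj_mult)
    qed
    have unit: "e (\<theta> $ a) * cnj (e (\<theta> $ a)) = 1"
      using complex_norm_square[of "e (\<theta> $ a)"] by (simp add: norm_e)
    have e: "e (\<theta> $ j) = of_real (\<sigma> $ j) * e (\<theta> $ a)" for j
      using arg_cong[OF rot[of j], of "\<lambda>z. e (\<theta> $ a) * z"] unit
      by (simp add: mult.commute flip: mult.assoc)
    have "cmod (of_real (\<sigma> $ j)) = 1" for j
      unfolding rot[symmetric] by (simp add: norm_mult norm_e)
    then have \<sigma>: "\<sigma> $ j = 1 \<or> \<sigma> $ j = -1" for j
      by (simp add: abs_eq_iff')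
    have a: "\<sigma> $ a = 1"
      using rot[of a] unit by (simp add: mult.commute)
    have "of_real (\<Sum>j\<in>UNIV. \<sigma> $ j) * e (\<theta> $ a) = 0"
      using zero by (simp add: sum_distrib_right flip: e)
    then have sum0: "(\<Sum>j\<in>UNIV. \<sigma> $ j) = 0"
      using norm_e[of "\<theta> $ a"] by (auto simp del: of_real_sum)
    \<comment> \<open>The signs add up to zero and so cannot all be 1; this provides a partner
      antipodal to \<open>a\<close>.\<close>
    obtain b where b: "\<sigma> $ b = -1"
    proof (rule ccontr)
      assume "\<not> thesis"
      then have "\<sigma> $ j = 1" for j using \<sigma> that by blast
      then show False using sum0 by simp
    qed
    \<comment> \<open>Rotating two antipodal phase factors together keeps their sum at zero, so the
      vector with ones at \<open>j\<close> and \<open>k\<close> is a kernel direction.\<close>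
    have opp: "L $ i $ k = - L $ i $ j" if jk: "\<sigma> $ j = 1" "\<sigma> $ k = -1" for i j k
    proof -
      have "j \<noteq> k" using jk by auto
      let ?v = "axis j 1 + axis k 1 :: real ^ 'n"
      define \<gamma> where "\<gamma> s = \<theta> + s *\<^sub>R ?v" for s
      have shift: "e (t + s) = e t * e s" for t s
        by (simp add: e_def algebra_simps exp_add)
      have "F (\<gamma> s) = c" for s
      proof (rule const)
        have "e (\<gamma> s $ l) = e (\<theta> $ l)" if "l \<in> UNIV - {j, k}" for l
          using that by (simp add: \<gamma>_def axis_def)
        moreover have "\<gamma> s $ j = \<theta> $ j + s" "\<gamma> s $ k = \<theta> $ k + s"
          using \<open>j \<noteq> k\<close> by (simp_all add: \<gamma>_def axis_def)
        moreover have "e (\<theta> $ k) = - e (\<theta> $ j)"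
          using e[of j] e[of k] jk by simp
        ultimately show "(\<Sum>l\<in>UNIV. e (\<gamma> s $ l)) = 0"
          using zero by (simp add: sum_remove_two[OF \<open>j \<noteq> k\<close>] shift)
      qed
      moreover have "(\<gamma> has_vector_derivative ?v) (at 0)"
        unfolding \<gamma>_def has_vector_derivative_def by (auto intro!: derivative_eq_intros)
      ultimately have "L *v ?v = 0"
        using jacobian_curve[of F \<gamma> ?v c] assms(3) by (simp add: \<gamma>_def L_def)
      then have "(L *v axis j 1 + L *v axis k 1) $ i = 0"
        by (simp add: matrix_vector_right_distrib)
      then show ?thesis by (simp add: L_axis)
    qed
    \<comment> \<open>A column of sign -1 is compared with \<open>a\<close> directly, a column of
      sign 1 by way of \<open>b\<close>.\<close>
    have L: "L $ i $ j = L $ i $ a * \<sigma> $ j" for i j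
      using \<sigma>[of j] opp[OF _ b, of j i] opp[OF a, of j i] opp[OF a b, of i] by auto
    show ?thesis
    proof (rule that)
      show "jacobian F \<theta> $ i $ j = (\<chi> i. L $ i $ a) $ i * \<sigma> $ j + 0 $ i * 0 $ j" for i j
        using L[of i j] by (simp add: L_def)
    qed
  qed
qed

section \<open>The vector field on the zero set of the order parameter, and the stability
  criterion\<close>

lemma periodic_each_argument_shift:
  fixes F :: "real ^ 'n \<Rightarrow> real ^ 'n" and k :: "'n \<Rightarrow> int"
  assumes "periodic_each_argument F"
  shows "F (\<chi> j. \<phi> $ j + 2 * pi * of_int (k j)) = F \<phi>"
proof -
  have nat: "F (x + of_nat n *\<^sub>R axis i (2 * pi)) = F x" for x i and n :: nat
  proof (induction n)
    case (Suc n)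
    have "x + of_nat (Suc n) *\<^sub>R axis i (2 * pi) = (x + of_nat n *\<^sub>R axis i (2 * pi)) + axis i (2 * pi)"
      by (simp add: algebra_simps)
    then show ?case using Suc assms unfolding periodic_each_argument_def by metis
  qed simp
  have int: "F (x + of_int n *\<^sub>R axis i (2 * pi)) = F x" for x i and n :: int
  proof (cases n)
    case (nonneg l)
    then show ?thesis using nat[of x l i] by simp
  next
    case (neg l)
    then show ?thesis
      \<comment> \<open>The natural-number case starts from the shifted point and climbs back to
        \<open>x\<close> in \<open>Suc l\<close> steps.\<close>
      using nat[of "x + of_int n *\<^sub>R axis i (2 * pi)" "Suc l" i] by (simp del: of_nat_Suc)
  qed
  have "F (\<phi> + (\<Sum>i\<in>S. of_int (k i) *\<^sub>R axis i (2 * pi))) = F \<phi>" if "finite S" for S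
    using that
  proof induction
    case (insert i S)
    then show ?case
      using int[of "\<phi> + (\<Sum>i\<in>S. of_int (k i) *\<^sub>R axis i (2 * pi))" "k i" i] by (simp add: add_ac)
  qed simp
  moreover have "(\<Sum>i\<in>UNIV. of_int (k i) *\<^sub>R axis i (2 * pi)) $ j = 2 * pi * of_int (k j)" for j
    by (simp add: axis_def if_distrib cong: if_cong)
  then have "\<phi> + (\<Sum>i\<in>UNIV. of_int (k i) *\<^sub>R axis i (2 * pi)) = (\<chi> j. \<phi> $ j + 2 * pi * of_int (k j))"
    by (simp add: vec_eq_iff)
  ultimately show ?thesis by (metis finite)
qed

lemma order_modulus_eq_0_iff:
  fixes \<phi> :: "real ^ 'n"
  shows "order_modulus m \<phi> = 0 \<longleftrightarrow> (\<Sum>j\<in>UNIV. exp (\<i> * of_nat m * complex_of_real (\<phi> $ j))) = 0"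
  by (simp add: order_modulus_def order_parameter_def)

text \<open>The solutions are given only for phases in the half-open box, whereas curves through a
  splay state may leave it. Reducing the phases modulo 2 pi changes neither the phase factors nor
  \<open>F\<close>, and the velocity of the solution at time 0 gives the value.\<close>

lemma splay_vector_field_const:
  fixes F :: "real ^ 'n \<Rightarrow> real ^ 'n"
  assumes "periodic_each_argument F"
    and sol: "\<forall>\<eta> \<in> splay_manifold m. oscillator_solution \<omega> F (\<lambda>t. (\<Omega> * t) *\<^sub>R 1 + \<eta>)"
    and zero: "(\<Sum>j\<in>UNIV. exp (\<i> * of_nat m * complex_of_real (\<phi> $ j))) = 0"
  shows "F \<phi> = (\<Omega> - \<omega>) *\<^sub>R 1"
proof -
  define k where "k j = - \<lfloor>\<phi> $ j / (2 * pi)\<rfloor>" for j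
  define \<eta> where "\<eta> = (\<chi> j. \<phi> $ j + 2 * pi * of_int (k j))"
  have "exp (\<i> * of_nat m * complex_of_real (\<eta> $ j)) = exp (\<i> * of_nat m * complex_of_real (\<phi> $ j))" for j
    \<comment> \<open>Shifting a phase by \<open>k j\<close> turns shifts its \<open>m\<close>-th
      multiple by \<open>m * k j\<close> turns, an integer.\<close>
    unfolding exp_eq by (rule exI[of _ "int m * k j"]) (simp add: \<eta>_def algebra_simps)
  then have "order_modulus m \<eta> = 0"
    by (simp add: order_modulus_eq_0_iff zero)
  moreover have "0 \<le> \<eta> $ j \<and> \<eta> $ j < 2 * pi" for j
    using floor_divide_lower[of "2 * pi" "\<phi> $ j"] floor_divide_upper[of "2 * pi" "\<phi> $ j"]
    by (simp add: \<eta>_def k_def algebra_simps)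
  ultimately have "\<eta> \<in> splay_manifold m" by (simp add: splay_manifold_def)
  with sol have "((\<lambda>t. (\<Omega> * t) *\<^sub>R 1 + \<eta>) has_vector_derivative \<omega> *\<^sub>R 1 + F ((\<Omega> * 0) *\<^sub>R 1 + \<eta>)) (at 0)"
    unfolding oscillator_solution_def by blast
  moreover have "((\<lambda>t. (\<Omega> * t) *\<^sub>R 1 + \<eta>) has_vector_derivative \<Omega> *\<^sub>R 1) (at 0)"
    by (auto intro!: derivative_eq_intros)
  ultimately have "\<omega> *\<^sub>R 1 + F \<eta> = \<Omega> *\<^sub>R 1"
    using vector_derivative_unique_at by force
  moreover have "F \<eta> = F \<phi>"
    unfolding \<eta>_def by (rule periodic_each_argument_shift[OF assms(1)])
  ultimately show ?thesis by (simp add: algebra_simps)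
qed

theorem proposition5:
  fixes F :: "real ^ 'n \<Rightarrow> real ^ 'n" and \<omega> \<Omega> :: real and m :: nat
    and \<theta> :: "real ^ 'n" and L :: "real ^ 'n ^ 'n"
  assumes "CARD('n) \<ge> 2" and "m \<ge> 1"
    and "continuously_differentiable F"
    and "periodic_each_argument F"
    and "phase_shift_invariant F"
    and "\<forall>\<eta> \<in> splay_manifold m. oscillator_solution \<omega> F (\<lambda>t. (\<Omega> * t) *\<^sub>R 1 + \<eta>)"
    and "\<theta> \<in> splay_manifold m"
    and "L = jacobian F \<theta>"
  shows "(2 * trace (L ** L) \<le> (trace L)\<^sup>2 \<longrightarrow>
            (linearly_stable_splay F \<theta> \<longleftrightarrow> trace L < 0)) \<and>
         (2 * trace (L ** L) > (trace L)\<^sup>2 \<longrightarrow>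
            (linearly_stable_splay F \<theta> \<longleftrightarrow> trace L < 0 \<and> trace (L ** L) < (trace L)\<^sup>2))"
proof -
  let ?e = "\<lambda>t. exp (\<i> * of_nat m * complex_of_real t)"
  have F: "F differentiable (at \<theta>)"
    using assms(3) by (simp add: continuously_differentiable_def)
  have const: "F \<phi> = (\<Omega> - \<omega>) *\<^sub>R 1" if "(\<Sum>j\<in>UNIV. ?e (\<phi> $ j)) = 0" for \<phi>
    using that by (rule splay_vector_field_const[OF assms(4,6)])
  have "(\<Sum>j\<in>UNIV. ?e (\<theta> $ j)) = 0"
    using assms(7) by (simp add: splay_manifold_def order_modulus_eq_0_iff)
  from splay_jacobian_rank_2[OF assms(2) F const this]
  obtain u p w q where "\<And>i j. L $ i $ j = u $ i * p $ j + w $ i * q $ j"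
    unfolding assms(8) by blast
  from stable_spectrum_rank_2[OF assms(1) this]
  have stable: "linearly_stable_splay F \<theta> \<longleftrightarrow> trace L < 0 \<and> trace (L ** L) < (trace L)\<^sup>2"
    unfolding linearly_stable_splay_def assms(8) .
  \<comment> \<open>In the first case the second stability condition is automatic: half of a
    positive square lies strictly below that square.\<close>
  have "trace (L ** L) < (trace L)\<^sup>2" if "2 * trace (L ** L) \<le> (trace L)\<^sup>2" "trace L < 0"
  proof -
    have "(trace L)\<^sup>2 > 0" using that(2) by simp
    with that(1) show ?thesis by linarith
  qed
  with stable show ?thesis by blast
qed

end
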